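(* Let $m\ge2$ and let $\Phi=\{\boldsymbol\varphi_1,\dots,\boldsymbol\varphi_N\}\subset\mathbb C^m$ be an equiangular tight frame (ETF). Any set of $n$ distinct points of $\{1,\dots,N\}$ and positive weights satisfying the weighted $L_2$ Marcinkiewicz--Zygmund inequality on the $m$-dimensional space $\mathcal F_\Phi$ with distortion $0\le\varepsilon<1$ obeys $$n\ge\max\Big\{m,\frac{N(1-\varepsilon^2)}{1+\frac{N-m}{m-1}\varepsilon^2}\Big\}.$$
   Context: An ETF for $\mathbb C^m$ is a family $\Phi=\{\boldsymbol\varphi_1,\dots,\boldsymbol\varphi_N\}\subset\mathbb C^m$ of unit vectors such that $|\langle\boldsymbol\varphi_i,\boldsymbol\varphi_j\rangle|$ is the same constant for all $i\ne j$ and $\sum_{i=1}^N|\langle\boldsymbol a,\boldsymbol\varphi_i\rangle|^2=\frac Nm\|\boldsymbol a\|_2^2$ for all $\boldsymbol a\in\mathbb C^m$. On $\Omega=\{1,\dots,N\}$ with the counting measure define $\mathcal F_\Phi=\{f_{\boldsymbol a}:\Omega\to\mathbb C,\ f_{\boldsymbol a}(i)=\sqrt{m/N}\,\langle\boldsymbol a,\boldsymbol\varphi_i\rangle\,:\ \boldsymbol a\in\mathbb C^m\}$, with $\|f\|_{L_2}^2=\sum_{i=1}^N|f(i)|^2$. Distinct points $x_1,\dots,x_n\in\Omega$ and weights $w_1,\dots,w_n>0$ satisfy the weighted $L_2$ Marcinkiewicz--Zygmund inequality on $\mathcal F_\Phi$ with distortion $\varepsilon$ if $(1-\varepsilon)\|f\|_{L_2}^2\le\sum_{i=1}^nw_i|f(x_i)|^2\le(1+\varepsilon)\|f\|_{L_2}^2$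 for all $f\in\mathcal F_\Phi$. *)

theory Defs
  imports "HOL-Analysis.Analysis"
begin

text \<open>
  The library provides only the real inner product on \<open>complex ^ 'm\<close>. The Hermitian one below
  is linear in the first argument and satisfies \<open>cinner a a = (norm a)\<^sup>2\<close>, since the library's
  norm on \<open>complex ^ 'm\<close> is the Euclidean one.
\<close>

definition cinner :: "complex ^ 'm \<Rightarrow> complex ^ 'm \<Rightarrow> complex" where
  "cinner a b = (\<Sum>k\<in>UNIV. a $ k * cnj (b $ k))"

text \<open>
  A family is indexed by \<open>{1..N}\<close>; values of \<open>\<phi>\<close> at other indices are irrelevant.
  The condition \<open>0 < N\<close> is needed because for the empty family every other condition,
  including the tight frame identity, holds vacuously.
\<close>

definition is_ETF :: "nat \<Rightarrow> (nat \<Rightarrow> complex ^ 'm) \<Rightarrow> bool" where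
  "is_ETF N \<phi> \<longleftrightarrow>
     0 < N \<and>
     (\<forall>i\<in>{1..N}. norm (\<phi> i) = 1) \<and>
     (\<exists>\<mu>::real. \<forall>i\<in>{1..N}. \<forall>j\<in>{1..N}. i \<noteq> j \<longrightarrow> cmod (cinner (\<phi> i) (\<phi> j)) = \<mu>) \<and>
     (\<forall>a. (\<Sum>i=1..N. (cmod (cinner a (\<phi> i)))\<^sup>2) = real N / real CARD('m) * (norm a)\<^sup>2)"

text \<open>
  Functions on \<open>{1..N}\<close> are represented as functions on \<open>nat\<close> vanishing outside \<open>{1..N}\<close>.
\<close>

definition frame_function :: "nat \<Rightarrow> (nat \<Rightarrow> complex ^ 'm) \<Rightarrow> complex ^ 'm \<Rightarrow> nat \<Rightarrow> complex" where
  "frame_function N \<phi> a i =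
     (if i \<in> {1..N}
      then complex_of_real (sqrt (real CARD('m) / real N)) * cinner a (\<phi> i)
      else 0)"

definition frame_space :: "nat \<Rightarrow> (nat \<Rightarrow> complex ^ 'm) \<Rightarrow> (nat \<Rightarrow> complex) set" where
  "frame_space N \<phi> = {frame_function N \<phi> a | a. True}"

definition L2_norm :: "'a set \<Rightarrow> ('a \<Rightarrow> complex) \<Rightarrow> real" where
  "L2_norm \<Omega> f = L2_set (\<lambda>i. cmod (f i)) \<Omega>"

text \<open>
  The points \<open>x 1, \<dots>, x n\<close> are distinct elements of \<open>\<Omega>\<close>, the weights \<open>w 1, \<dots>, w n\<close> are
  positive, and \<open>\<Omega>\<close> is a finite set with the counting measure.
\<close>

definition weighted_MZ ::
  "'a set \<Rightarrow> ('a \<Rightarrow> complex) set \<Rightarrow> nat \<Rightarrow> (nat \<Rightarrow> 'a) \<Rightarrow> (nat \<Rightarrow> real) \<Rightarrow> real \<Rightarrow> bool" where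
  "weighted_MZ \<Omega> F n x w \<epsilon> \<longleftrightarrow>
     x ` {1..n} \<subseteq> \<Omega> \<and> inj_on x {1..n} \<and>
     (\<forall>i\<in>{1..n}. 0 < w i) \<and>
     (\<forall>f\<in>F. (1 - \<epsilon>) * (L2_norm \<Omega> f)\<^sup>2 \<le> (\<Sum>i=1..n. w i * (cmod (f (x i)))\<^sup>2) \<and>
             (\<Sum>i=1..n. w i * (cmod (f (x i)))\<^sup>2) \<le> (1 + \<epsilon>) * (L2_norm \<Omega> f)\<^sup>2)"

end

theory Submission
  imports Defs
begin

text \<open>
  Put \<open>m = CARD('m)\<close> and \<open>v i = w i * m / N\<close>. The inequality says that the operator
  \<open>T a = (\<Sum>i. v i \<langle>a, \<phi> (x i)\<rangle> \<phi> (x i))\<close> has all its eigenvalues in \<open>[1 - \<epsilon>, 1 + \<epsilon>]\<close>.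

  The bound \<open>n \<ge> m\<close> holds because \<open>T\<close> is positive definite, so that no nonzero vector is
  orthogonal to all \<open>\<phi> (x i)\<close>, whereas fewer than \<open>m\<close> vectors always admit such a vector
  (lemma \<open>orthogonal_to_few_vectors\<close>).

  For the other bound, an eigenvalue \<open>t\<close> satisfies \<open>(t - (1 - \<epsilon>)) ((1 + \<epsilon>) - t) \<ge> 0\<close>; summing over
  the eigenvalues gives \<open>m (1 - \<epsilon>\<^sup>2) + tr (T\<^sup>2) \<le> 2 tr T\<close>, and by the inequality between the
  arithmetic and the geometric mean \<open>m (1 - \<epsilon>\<^sup>2) tr (T\<^sup>2) \<le> (tr T)\<^sup>2\<close>. Both traces are explicit:
  \<open>tr T = \<Sum> v i\<close>, and \<open>tr (T\<^sup>2) = \<Sum>\<Sum> v i v j \<bar>\<langle>\<phi> (x i), \<phi> (x j)\<rangle>\<bar>\<^sup>2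
  = (1 - \<mu>\<^sup>2) \<Sum> (v i)\<^sup>2 + \<mu>\<^sup>2 (\<Sum> v i)\<^sup>2\<close>, where \<open>\<mu>\<close> is the common modulus of the inner products.
  With \<open>(\<Sum> v i)\<^sup>2 \<le> n \<Sum> (v i)\<^sup>2\<close> and \<open>\<mu>\<^sup>2 = (N - m) / (m (N - 1))\<close> this is the claim.

  No spectral decomposition is needed: the operator inequality
  \<open>\<parallel>A a\<parallel>\<^sup>2 \<le> c \<langle>A a, a\<rangle>\<close> for \<open>0 \<le> A \<le> c\<close> (lemma \<open>norm_sq_le_quadratic_form\<close>), applied to
  \<open>A = T - (1 - \<epsilon>)\<close>, \<open>c = 2 \<epsilon>\<close> and the standard basis vectors \<open>a\<close>, replaces it.
\<close>

section \<open>The Hermitian inner product\<close>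

lemma cinner_commute: "cinner b a = cnj (cinner a b)"
  by (simp add: cinner_def mult.commute)

lemma Re_cinner: "Re (cinner a b) = inner a b"
  by (simp add: cinner_def inner_vec_def inner_complex_def)

lemma cinner_self: "cinner a a = complex_of_real ((norm a)\<^sup>2)"
proof -
  have "cinner a a = complex_of_real (\<Sum>k\<in>UNIV. (norm (a $ k))\<^sup>2)"
    by (simp only: cinner_def complex_norm_square [symmetric] of_real_sum)
  then show ?thesis
    by (simp add: norm_vec_def L2_set_def sum_nonneg)
qed

lemma cinner_axis: "cinner (axis k 1) b = cnj (b $ k)"
  by (simp add: cinner_def axis_def if_distrib [where f = "\<lambda>z. z * _"] cong: if_cong)

lemma norm_axis_one: "norm (axis k (1::complex)) = 1"
  by (rule norm_Basis) (simp add: axis_in_Basis_iff)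

lemma cinner_scale_left: "cinner (c *s a) b = c * cinner a b"
  by (simp add: cinner_def sum_distrib_left mult.assoc)

lemma cinner_scale_right: "cinner a (c *s b) = cnj c * cinner a b"
  by (simp add: cinner_def sum_distrib_left mult_ac)

lemma cinner_sum_left: "cinner (\<Sum>i\<in>I. f i) b = (\<Sum>i\<in>I. cinner (f i) b)"
  unfolding cinner_def sum_component sum_distrib_right by (rule sum.swap)

lemma cinner_sum_right: "cinner b (\<Sum>i\<in>I. f i) = (\<Sum>i\<in>I. cinner b (f i))"
  by (simp add: cinner_commute [of b] cinner_sum_left)

lemma cinner_add_left: "cinner (a + a') b = cinner a b + cinner a' b"
  by (simp add: cinner_def distrib_right sum.distrib)

lemma cinner_scaleR_left: "cinner (r *\<^sub>R a) b = complex_of_real r * cinner a b"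
  by (simp add: cinner_def sum_distrib_left scaleR_conv_of_real[where 'a = complex] mult.assoc)

text \<open>
  Over the reals, a vector and its product with \<open>\<i>\<close> span what it spans over the complex numbers;
  hence the real dimension \<open>2 * CARD('m)\<close> is compared with \<open>2 * card S\<close>.
\<close>

lemma orthogonal_to_few_vectors:
  fixes S :: "(complex ^ 'm) set"
  assumes "finite S" and "card S < CARD('m)"
  obtains a where "a \<noteq> 0" and "\<And>b. b \<in> S \<Longrightarrow> cinner a b = 0"
proof -
  let ?U = "S \<union> (\<lambda>b. \<i> *s b) ` S"
  have "dim (span ?U) \<le> card ?U"
    using assms(1) by (simp add: dim_le_card')
  also have "\<dots> \<le> card S + card S"
    using card_Un_le [of S "(\<lambda>b. \<i> *s b) ` S"] card_image_le [OF assms(1), of "\<lambda>b. \<i> *s b"]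
    by linarith
  also have "\<dots> < DIM(complex ^ 'm)"
    using assms(2) by simp
  finally obtain a :: "complex ^ 'm" where a: "a \<noteq> 0" "\<And>y. y \<in> span (span ?U) \<Longrightarrow> orthogonal a y"
    using orthogonal_to_subspace_exists [of "span ?U"] by auto
  have orth: "inner a y = 0" if "y \<in> ?U" for y
    using a(2) [of y] that by (simp add: span_base orthogonal_def)
  have "cinner a b = 0" if "b \<in> S" for b
  proof (rule complex_eqI)
    show "Re (cinner a b) = Re 0"
      using orth that by (simp add: Re_cinner)
    have "Re (cinner a (\<i> *s b)) = 0"
      using orth [of "\<i> *s b"] that by (simp only: Re_cinner) blast
    then show "Im (cinner a b) = Im 0"
      by (simp add: cinner_scale_right)
  qed
  with a(1) that show thesis by blast
qed

section \<open>Self-adjoint operators with bounded quadratic form\<close>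

text \<open>
  The form is nonnegative at \<open>a - t A a\<close>, and its upper bound at \<open>A a\<close> controls the term
  in \<open>t\<^sup>2\<close>. This gives a quadratic polynomial in \<open>t\<close> that is nonnegative everywhere.
\<close>

lemma norm_sq_le_quadratic_form:
  fixes A :: "'a::real_inner \<Rightarrow> 'a"
  assumes "linear A" and sym: "\<And>a b. inner (A a) b = inner a (A b)"
    and pos: "\<And>a. 0 \<le> inner (A a) a"
    and upper: "\<And>a. inner (A a) a \<le> c * (norm a)\<^sup>2"
  shows "(norm (A a))\<^sup>2 \<le> c * inner (A a) a"
proof -
  interpret linear A by fact
  define s where "s = (norm (A a))\<^sup>2"
  have s: "s = inner (A a) (A a)"
    by (simp add: s_def power2_norm_eq_inner)
  have nonneg: "0 \<le> inner (A a) a - 2 * t * s + t\<^sup>2 * (c * s)" for t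
  proof -
    have "0 \<le> inner (A (a - t *\<^sub>R A a)) (a - t *\<^sub>R A a)"
      by (rule pos)
    also have "\<dots> = inner (A a) a - 2 * t * s + t\<^sup>2 * inner (A (A a)) (A a)"
      by (simp add: diff scale inner_diff_left inner_diff_right s sym [of "A a" a]
          power2_eq_square algebra_simps)
    also have "\<dots> \<le> inner (A a) a - 2 * t * s + t\<^sup>2 * (c * s)"
      using upper [of "A a"] by (auto intro: mult_left_mono simp: s_def)
    finally show ?thesis .
  qed
  have "0 \<le> s"
    by (simp add: s_def)
  show ?thesis
  proof (cases "c > 0")
    case True
    \<comment> \<open>The minimum of the polynomial is at \<open>t = 1 / c\<close>.\<close>
    then have "0 \<le> inner (A a) a - s / c"
      using nonneg [of "1 / c"] by (simp add: power2_eq_square)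
    with True show ?thesis
      by (simp add: s_def field_simps)
  next
    case False
    \<comment> \<open>In this case the form vanishes identically.\<close>
    then have "inner (A b) b = 0" for b
      using pos [of b] upper [of b] mult_nonpos_nonneg [of c "(norm b)\<^sup>2"] by simp
    moreover have "c * s \<le> 0"
      using False \<open>0 \<le> s\<close> by (simp add: mult_nonpos_nonneg)
    ultimately have "s = 0"
      using nonneg [of 1] \<open>0 \<le> s\<close> by simp
    with \<open>inner (A a) a = 0\<close> show ?thesis
      by (simp add: s_def)
  qed
qed

text \<open>Every eigenvalue \<open>t\<close> satisfies \<open>\<alpha> \<beta> + t\<^sup>2 \<le> (\<alpha> + \<beta>) t\<close>; this is the operator form.\<close>

lemma norm_sq_le_if_form_between:
  fixes T :: "'a::real_inner \<Rightarrow> 'a"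
  assumes "linear T" and sym: "\<And>a b. inner (T a) b = inner a (T b)"
    and lower: "\<And>a. \<alpha> * (norm a)\<^sup>2 \<le> inner (T a) a"
    and upper: "\<And>a. inner (T a) a \<le> \<beta> * (norm a)\<^sup>2"
  shows "\<alpha> * \<beta> * (norm a)\<^sup>2 + (norm (T a))\<^sup>2 \<le> (\<alpha> + \<beta>) * inner (T a) a"
proof -
  let ?A = "\<lambda>a. T a - \<alpha> *\<^sub>R a"
  have form: "inner (?A a) a = inner (T a) a - \<alpha> * (norm a)\<^sup>2" for a
    by (simp add: inner_diff_left power2_norm_eq_inner)
  have "linear ?A"
    using assms(1) by (intro linear_compose_sub linear_scale_self) auto
  then have "(norm (?A a))\<^sup>2 \<le> (\<beta> - \<alpha>) * inner (?A a) a"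
  proof (rule norm_sq_le_quadratic_form)
    show "inner (?A a) b = inner a (?A b)" for a b
      by (simp add: inner_diff_left inner_diff_right sym)
    show "0 \<le> inner (?A a) a" for a
      using lower [of a] by (simp add: form)
    show "inner (?A a) a \<le> (\<beta> - \<alpha>) * (norm a)\<^sup>2" for a
      using upper [of a] by (simp only: form left_diff_distrib)
  qed
  moreover have "(norm (?A a))\<^sup>2 = (norm (T a))\<^sup>2 - 2 * \<alpha> * inner (T a) a + \<alpha>\<^sup>2 * (norm a)\<^sup>2"
    by (simp only: power2_norm_eq_inner inner_diff_left inner_diff_right inner_scaleR_left
        inner_scaleR_right inner_commute [of a "T a"]) (simp add: power2_eq_square algebra_simps)
  ultimately show ?thesis
    by (simp only: form) (simp add: algebra_simps power2_eq_square)
qed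

section \<open>Weighted frame operators\<close>

text \<open>The operator \<open>\<Sum>i\<in>I. v i \<psi>\<^sub>i \<psi>\<^sub>i\<^sup>*\<close>.\<close>

definition frame_operator ::
  "'i set \<Rightarrow> ('i \<Rightarrow> real) \<Rightarrow> ('i \<Rightarrow> complex ^ 'm) \<Rightarrow> complex ^ 'm \<Rightarrow> complex ^ 'm" where
  "frame_operator I v \<psi> a = (\<Sum>i\<in>I. (complex_of_real (v i) * cinner a (\<psi> i)) *s \<psi> i)"

lemma cinner_frame_operator:
  "cinner (frame_operator I v \<psi> a) b
    = (\<Sum>i\<in>I. complex_of_real (v i) * (cinner a (\<psi> i) * cinner (\<psi> i) b))"
  by (simp add: frame_operator_def cinner_sum_left cinner_scale_left mult.assoc)

lemma linear_frame_operator: "linear (frame_operator I v \<psi>)"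
proof (rule linearI)
  show "frame_operator I v \<psi> (a + b) = frame_operator I v \<psi> a + frame_operator I v \<psi> b" for a b
    by (simp add: frame_operator_def cinner_add_left distrib_left sum.distrib vector_sadd_rdistrib)
  show "frame_operator I v \<psi> (r *\<^sub>R a) = r *\<^sub>R frame_operator I v \<psi> a" for r a
    by (simp add: frame_operator_def cinner_scaleR_left vec_eq_iff scaleR_sum_right
        sum_component scaleR_conv_of_real[where 'a = complex] mult_ac)
qed

lemma frame_operator_self_adjoint:
  "inner (frame_operator I v \<psi> a) b = inner a (frame_operator I v \<psi> b)"
proof -
  have "cinner (frame_operator I v \<psi> b) a = cnj (cinner (frame_operator I v \<psi> a) b)"
    by (simp add: cinner_frame_operator flip: cinner_commute) (simp add: mult.commute)
  then have "Re (cinner (frame_operator I v \<psi> b) a) = Re (cinner (frame_operator I v \<psi> a) b)"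
    by simp
  then show ?thesis
    by (simp add: Re_cinner inner_commute)
qed

lemma frame_operator_form:
  "inner (frame_operator I v \<psi> a) a = (\<Sum>i\<in>I. v i * (cmod (cinner a (\<psi> i)))\<^sup>2)"
proof -
  have "cinner (frame_operator I v \<psi> a) a
      = (\<Sum>i\<in>I. complex_of_real (v i) * (cinner a (\<psi> i) * cnj (cinner a (\<psi> i))))"
    by (simp add: cinner_frame_operator flip: cinner_commute)
  also have "\<dots> = complex_of_real (\<Sum>i\<in>I. v i * (cmod (cinner a (\<psi> i)))\<^sup>2)"
    by (simp only: complex_norm_square [symmetric] of_real_mult of_real_sum)
  finally show ?thesis
    by (simp flip: Re_cinner)
qed

lemma frame_operator_trace:
  "(\<Sum>k\<in>UNIV. inner (frame_operator I v \<psi> (axis k 1)) (axis k 1)) = (\<Sum>i\<in>I. v i * (norm (\<psi> i))\<^sup>2)"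
proof -
  have "(\<Sum>k\<in>UNIV. inner (frame_operator I v \<psi> (axis k 1)) (axis k 1))
      = (\<Sum>i\<in>I. v i * (\<Sum>k\<in>UNIV. (cmod (\<psi> i $ k))\<^sup>2))"
    unfolding frame_operator_form cinner_axis complex_mod_cnj sum_distrib_left by (rule sum.swap)
  then show ?thesis
    by (simp add: norm_vec_def L2_set_def sum_nonneg)
qed

lemma frame_operator_trace_square:
  "(\<Sum>k\<in>UNIV. (norm (frame_operator I v \<psi> (axis k 1)))\<^sup>2)
    = (\<Sum>i\<in>I. \<Sum>j\<in>I. v i * v j * (cmod (cinner (\<psi> i) (\<psi> j)))\<^sup>2)"
proof -
  let ?T = "frame_operator I v \<psi>"
  let ?c = complex_of_real
  have "?c ((norm (?T (axis k 1)))\<^sup>2)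
      = (\<Sum>i\<in>I. \<Sum>j\<in>I. ?c (v i * v j) * cinner (\<psi> i) (\<psi> j) * (\<psi> j $ k * cnj (\<psi> i $ k)))" for k
  proof -
    have "cinner b (?T (axis k 1)) = (\<Sum>j\<in>I. ?c (v j) * \<psi> j $ k * cinner b (\<psi> j))" for b
      by (simp add: frame_operator_def cinner_sum_right cinner_scale_right cinner_axis)
    note right = this
    have "?c ((norm (?T (axis k 1)))\<^sup>2) = cinner (?T (axis k 1)) (?T (axis k 1))"
      by (simp only: cinner_self)
    also have "\<dots> = (\<Sum>i\<in>I. ?c (v i) * (cnj (\<psi> i $ k) * cinner (\<psi> i) (?T (axis k 1))))"
      by (simp only: cinner_frame_operator cinner_axis)
    also have "\<dots> = (\<Sum>i\<in>I. \<Sum>j\<in>I.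
        ?c (v i * v j) * cinner (\<psi> i) (\<psi> j) * (\<psi> j $ k * cnj (\<psi> i $ k)))"
      by (simp add: right sum_distrib_left mult_ac)
    finally show ?thesis .
  qed
  then have "?c (\<Sum>k\<in>UNIV. (norm (?T (axis k 1)))\<^sup>2)
      = (\<Sum>k\<in>UNIV. \<Sum>i\<in>I. \<Sum>j\<in>I.
          ?c (v i * v j) * cinner (\<psi> i) (\<psi> j) * (\<psi> j $ k * cnj (\<psi> i $ k)))"
    by (simp only: of_real_sum)
  also have "\<dots> = (\<Sum>i\<in>I. \<Sum>j\<in>I. \<Sum>k\<in>UNIV.
          ?c (v i * v j) * cinner (\<psi> i) (\<psi> j) * (\<psi> j $ k * cnj (\<psi> i $ k)))"
    by (subst sum.swap) (intro sum.cong refl sum.swap)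
  also have "\<dots> = (\<Sum>i\<in>I. \<Sum>j\<in>I. ?c (v i * v j) * cinner (\<psi> i) (\<psi> j) * cinner (\<psi> j) (\<psi> i))"
    unfolding sum_distrib_left [symmetric] cinner_def [symmetric] by (rule refl)
  also have "\<dots> = (\<Sum>i\<in>I. \<Sum>j\<in>I. ?c (v i * v j) * (cinner (\<psi> i) (\<psi> j) * cinner (\<psi> j) (\<psi> i)))"
    by (simp only: mult.assoc)
  also have "\<dots> = ?c (\<Sum>i\<in>I. \<Sum>j\<in>I. v i * v j * (cmod (cinner (\<psi> i) (\<psi> j)))\<^sup>2)"
    by (simp only: of_real_sum of_real_mult complex_norm_square cinner_commute [symmetric])
  finally show ?thesis
    by (simp only: of_real_eq_iff)
qed

text \<open>The trace of \<open>(T - \<alpha>) (\<beta> - T) \<ge> 0\<close>.\<close>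

lemma frame_operator_trace_inequality:
  fixes \<psi> :: "'i \<Rightarrow> complex ^ 'm"
  assumes lower: "\<And>a. \<alpha> * (norm a)\<^sup>2 \<le> (\<Sum>i\<in>I. v i * (cmod (cinner a (\<psi> i)))\<^sup>2)"
    and upper: "\<And>a. (\<Sum>i\<in>I. v i * (cmod (cinner a (\<psi> i)))\<^sup>2) \<le> \<beta> * (norm a)\<^sup>2"
  shows "\<alpha> * \<beta> * real CARD('m) + (\<Sum>i\<in>I. \<Sum>j\<in>I. v i * v j * (cmod (cinner (\<psi> i) (\<psi> j)))\<^sup>2)
    \<le> (\<alpha> + \<beta>) * (\<Sum>i\<in>I. v i * (norm (\<psi> i))\<^sup>2)"
proof -
  let ?T = "frame_operator I v \<psi>"
  have pointwise: "\<alpha> * \<beta> * (norm a)\<^sup>2 + (norm (?T a))\<^sup>2 \<le> (\<alpha> + \<beta>) * inner (?T a) a" for a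
    using linear_frame_operator frame_operator_self_adjoint
    by (rule norm_sq_le_if_form_between) (simp_all only: frame_operator_form lower upper)
  have "(\<Sum>k\<in>(UNIV::'m set). \<alpha> * \<beta> + (norm (?T (axis k 1)))\<^sup>2)
      \<le> (\<Sum>k\<in>UNIV. (\<alpha> + \<beta>) * inner (?T (axis k 1)) (axis k 1))"
    using pointwise [of "axis _ 1"] by (intro sum_mono) (simp add: norm_axis_one)
  then show ?thesis
    by (simp only: sum.distrib frame_operator_trace_square frame_operator_trace
        sum_distrib_left [symmetric] sum_constant) (simp only: mult.commute)
qed

section \<open>Equiangular tight frames\<close>

lemma L2_norm_frame_function:
  fixes \<phi> :: "nat \<Rightarrow> complex ^ 'm"
  assumes "is_ETF N \<phi>"
  shows "(L2_norm {1..N} (frame_function N \<phi> a))\<^sup>2 = (norm a)\<^sup>2"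
proof -
  have N: "0 < N"
    and tight: "(\<Sum>i=1..N. (cmod (cinner a (\<phi> i)))\<^sup>2) = real N / real CARD('m) * (norm a)\<^sup>2"
    using assms by (auto simp: is_ETF_def)
  have "(L2_norm {1..N} (frame_function N \<phi> a))\<^sup>2
      = real CARD('m) / real N * (\<Sum>i=1..N. (cmod (cinner a (\<phi> i)))\<^sup>2)"
    by (simp add: L2_norm_def L2_set_def frame_function_def sum_nonneg norm_mult
        power_mult_distrib sum_distrib_left)
  then show ?thesis
    unfolding tight using N by simp
qed

text \<open>The common modulus attains the Welch bound.\<close>

lemma ETF_angle:
  fixes \<phi> :: "nat \<Rightarrow> complex ^ 'm"
  assumes "is_ETF N \<phi>" and "2 \<le> N"
  obtains \<mu> where "\<And>i j. \<lbrakk>i \<in> {1..N}; j \<in> {1..N}; i \<noteq> j\<rbrakk> \<Longrightarrow> cmod (cinner (\<phi> i) (\<phi> j)) = \<mu>"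
    and "\<mu>\<^sup>2 = (real N - real CARD('m)) / (real CARD('m) * (real N - 1))"
proof -
  from assms(1) obtain \<mu> where unit: "\<And>i. i \<in> {1..N} \<Longrightarrow> norm (\<phi> i) = 1"
    and \<mu>: "\<And>i j. \<lbrakk>i \<in> {1..N}; j \<in> {1..N}; i \<noteq> j\<rbrakk> \<Longrightarrow> cmod (cinner (\<phi> i) (\<phi> j)) = \<mu>"
    and tight: "\<And>a. (\<Sum>i=1..N. (cmod (cinner a (\<phi> i)))\<^sup>2) = real N / real CARD('m) * (norm a)\<^sup>2"
    unfolding is_ETF_def by metis
  have "real N / real CARD('m) = (\<Sum>i=1..N. (cmod (cinner (\<phi> 1) (\<phi> i)))\<^sup>2)"
    unfolding tight using unit [of 1] assms(2) by simp
  also have "\<dots> = (cmod (cinner (\<phi> 1) (\<phi> 1)))\<^sup>2 + (\<Sum>i\<in>{1..N} - {1}. (cmod (cinner (\<phi> 1) (\<phi> i)))\<^sup>2)"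
    using assms(2) by (intro sum.remove) auto
  also have "(\<Sum>i\<in>{1..N} - {1}. (cmod (cinner (\<phi> 1) (\<phi> i)))\<^sup>2) = (\<Sum>i\<in>{1..N} - {1}. \<mu>\<^sup>2)"
    using assms(2) by (intro sum.cong refl arg_cong [where f = "\<lambda>t. t\<^sup>2"] \<mu>) auto
  finally have "real N / real CARD('m) = 1 + (real N - 1) * \<mu>\<^sup>2"
    using unit [of 1] assms(2) by (simp add: cinner_self of_nat_diff)
  then have "real N = (1 + (real N - 1) * \<mu>\<^sup>2) * real CARD('m)"
    by (simp add: nonzero_divide_eq_eq)
  then have "real CARD('m) * (real N - 1) * \<mu>\<^sup>2 = real N - real CARD('m)"
    by (simp add: algebra_simps)
  moreover have "real CARD('m) * (real N - 1) \<noteq> 0"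
    using assms(2) by simp
  ultimately have "\<mu>\<^sup>2 = (real N - real CARD('m)) / (real CARD('m) * (real N - 1))"
    by (simp add: nonzero_eq_divide_eq mult.commute)
  with \<mu> show thesis by (rule that)
qed

lemma equiangular_trace_square:
  assumes "finite I"
    and unit: "\<And>i. i \<in> I \<Longrightarrow> norm (\<psi> i) = 1"
    and angle: "\<And>i j. \<lbrakk>i \<in> I; j \<in> I; i \<noteq> j\<rbrakk> \<Longrightarrow> cmod (cinner (\<psi> i) (\<psi> j)) = \<mu>"
  shows "(\<Sum>i\<in>I. \<Sum>j\<in>I. v i * v j * (cmod (cinner (\<psi> i) (\<psi> j)))\<^sup>2)
    = (1 - \<mu>\<^sup>2) * (\<Sum>i\<in>I. (v i)\<^sup>2) + \<mu>\<^sup>2 * (\<Sum>i\<in>I. v i)\<^sup>2"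
proof -
  have "(\<Sum>i\<in>I. \<Sum>j\<in>I. v i * v j * (cmod (cinner (\<psi> i) (\<psi> j)))\<^sup>2)
      = (\<Sum>i\<in>I. \<Sum>j\<in>I. \<mu>\<^sup>2 * (v i * v j) + (if i = j then (1 - \<mu>\<^sup>2) * (v i)\<^sup>2 else 0))"
    by (intro sum.cong refl)
      (auto simp: angle unit cinner_self algebra_simps power2_eq_square)
  also have "\<dots> = \<mu>\<^sup>2 * (\<Sum>i\<in>I. \<Sum>j\<in>I. v i * v j) + (1 - \<mu>\<^sup>2) * (\<Sum>i\<in>I. (v i)\<^sup>2)"
    using assms(1) by (simp add: sum.distrib sum_distrib_left)
  finally show ?thesis
    by (simp add: power2_eq_square sum_product)
qed

lemma MZ_frame_bounds:
  fixes \<phi> :: "nat \<Rightarrow> complex ^ 'm"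
  assumes "is_ETF N \<phi>" and "weighted_MZ {1..N} (frame_space N \<phi>) n x w \<epsilon>"
  defines "v \<equiv> \<lambda>i. w i * (real CARD('m) / real N)"
  shows "(1 - \<epsilon>) * (norm a)\<^sup>2 \<le> (\<Sum>i=1..n. v i * (cmod (cinner a (\<phi> (x i))))\<^sup>2)"
    and "(\<Sum>i=1..n. v i * (cmod (cinner a (\<phi> (x i))))\<^sup>2) \<le> (1 + \<epsilon>) * (norm a)\<^sup>2"
proof -
  let ?f = "frame_function N \<phi> a"
  have x: "x i \<in> {1..N}" if "i \<in> {1..n}" for i
    using assms(2) that unfolding weighted_MZ_def by blast
  have "(\<Sum>i=1..n. w i * (cmod (?f (x i)))\<^sup>2) = (\<Sum>i=1..n. v i * (cmod (cinner a (\<phi> (x i))))\<^sup>2)"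
    using x by (intro sum.cong refl)
      (simp add: frame_function_def v_def norm_mult power_mult_distrib)
  moreover have "?f \<in> frame_space N \<phi>"
    by (auto simp: frame_space_def)
  ultimately show "(1 - \<epsilon>) * (norm a)\<^sup>2 \<le> (\<Sum>i=1..n. v i * (cmod (cinner a (\<phi> (x i))))\<^sup>2)"
    and "(\<Sum>i=1..n. v i * (cmod (cinner a (\<phi> (x i))))\<^sup>2) \<le> (1 + \<epsilon>) * (norm a)\<^sup>2"
    using assms(2) L2_norm_frame_function [OF assms(1), of a] by (auto simp: weighted_MZ_def)
qed

theorem theorem3p2:
  fixes \<phi> :: "nat \<Rightarrow> complex ^ 'm"
    and N n :: nat
    and x :: "nat \<Rightarrow> nat"
    and w :: "nat \<Rightarrow> real"
    and \<epsilon> :: real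
  assumes "2 \<le> CARD('m)"
    and "is_ETF N \<phi>"
    and "0 \<le> \<epsilon>" and "\<epsilon> < 1"
    and "weighted_MZ {1..N} (frame_space N \<phi>) n x w \<epsilon>"
  shows "real n \<ge> max (real CARD('m))
           (real N * (1 - \<epsilon>\<^sup>2) /
             (1 + (real N - real CARD('m)) / (real CARD('m) - 1) * \<epsilon>\<^sup>2))"
proof -
  define m where "m = real CARD('m)"
  define v where "v = (\<lambda>i. w i * (real CARD('m) / real N))"
  define \<psi> where "\<psi> = (\<lambda>i. \<phi> (x i))"
  have x: "x ` {1..n} \<subseteq> {1..N}" "inj_on x {1..n}"
    using assms(5) by (auto simp: weighted_MZ_def)
  have lower: "(1 - \<epsilon>) * (norm a)\<^sup>2 \<le> (\<Sum>i=1..n. v i * (cmod (cinner a (\<psi> i)))\<^sup>2)"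
    and upper: "(\<Sum>i=1..n. v i * (cmod (cinner a (\<psi> i)))\<^sup>2) \<le> (1 + \<epsilon>) * (norm a)\<^sup>2" for a
    using MZ_frame_bounds [OF assms(2,5), of a] by (simp_all only: v_def \<psi>_def)

  have dim_le: "CARD('m) \<le> n"
  proof (rule ccontr)
    assume "\<not> CARD('m) \<le> n"
    moreover have "card (\<psi> ` {1..n}) \<le> n"
      using card_image_le [of "{1..n}" \<psi>] by simp
    ultimately have "card (\<psi> ` {1..n}) < CARD('m)" by linarith
    then obtain a where a: "a \<noteq> 0" "\<And>b. b \<in> \<psi> ` {1..n} \<Longrightarrow> cinner a b = 0"
      using orthogonal_to_few_vectors [of "\<psi> ` {1..n}"] by blast
    have "(1 - \<epsilon>) * (norm a)\<^sup>2 \<le> 0"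
      using lower [of a] a(2) by simp
    with a(1) assms(4) show False
      by (simp add: mult_le_0_iff)
  qed
  have "n \<le> N"
    using card_inj_on_le [OF x(2,1)] by simp
  have m: "2 \<le> m" "m \<le> real n" "real n \<le> real N"
    using assms(1) dim_le \<open>n \<le> N\<close> by (simp_all add: m_def)

  obtain \<mu> where \<mu>: "\<And>i j. \<lbrakk>i \<in> {1..N}; j \<in> {1..N}; i \<noteq> j\<rbrakk> \<Longrightarrow> cmod (cinner (\<phi> i) (\<phi> j)) = \<mu>"
    and \<mu>_sq: "\<mu>\<^sup>2 = (real N - m) / (m * (real N - 1))"
    using ETF_angle [OF assms(2)] m by (auto simp: m_def)
  have unit: "norm (\<psi> i) = 1" if "i \<in> {1..n}" for i
    using assms(2) x(1) that unfolding is_ETF_def \<psi>_def by blast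
  have angle: "cmod (cinner (\<psi> i) (\<psi> j)) = \<mu>" if "i \<in> {1..n}" "j \<in> {1..n}" "i \<noteq> j" for i j
    unfolding \<psi>_def using x that by (intro \<mu>) (blast dest: inj_onD)+

  define \<kappa> where "\<kappa> = 1 - \<epsilon>\<^sup>2"
  define S where "S = (\<Sum>i=1..n. v i)"
  define Q where "Q = (\<Sum>i=1..n. (v i)\<^sup>2)"
  define P where "P = (1 - \<mu>\<^sup>2) * Q + \<mu>\<^sup>2 * S\<^sup>2"
  have "0 < \<kappa>"
    using assms(3,4) abs_square_less_1 [of \<epsilon>] by (simp add: \<kappa>_def)
  have "(1 - \<epsilon>) * (1 + \<epsilon>) * m
      + (\<Sum>i=1..n. \<Sum>j=1..n. v i * v j * (cmod (cinner (\<psi> i) (\<psi> j)))\<^sup>2)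
    \<le> ((1 - \<epsilon>) + (1 + \<epsilon>)) * (\<Sum>i=1..n. v i * (norm (\<psi> i))\<^sup>2)"
    unfolding m_def by (rule frame_operator_trace_inequality [OF lower upper])
  moreover have "(\<Sum>i=1..n. v i * (norm (\<psi> i))\<^sup>2) = S"
    unfolding S_def using unit by (intro sum.cong) auto
  moreover have "(\<Sum>i=1..n. \<Sum>j=1..n. v i * v j * (cmod (cinner (\<psi> i) (\<psi> j)))\<^sup>2) = P"
    unfolding P_def Q_def S_def using unit angle by (intro equiangular_trace_square) auto
  moreover have "(1 - \<epsilon>) * (1 + \<epsilon>) = \<kappa>"
    by (simp add: \<kappa>_def power2_eq_square algebra_simps)
  ultimately have trace: "\<kappa> * m + P \<le> 2 * S"
    by simp
  have one_minus: "1 - \<mu>\<^sup>2 = real N * (m - 1) / (m * (real N - 1))"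
    using m by (simp add: \<mu>_sq field_simps)
  then have "0 \<le> 1 - \<mu>\<^sup>2"
    using m by simp
  moreover have "0 \<le> Q"
    by (simp add: Q_def sum_nonneg)
  ultimately have "0 \<le> P"
    by (simp add: P_def)
  moreover have "0 < \<kappa> * m"
    using \<open>0 < \<kappa>\<close> m by simp
  ultimately have "0 < S"
    using trace by linarith
  have "4 * (\<kappa> * m * P) \<le> (\<kappa> * m + P)\<^sup>2"
    using zero_le_power2 [of "\<kappa> * m - P"] by (simp add: power2_eq_square algebra_simps)
  also have "\<dots> \<le> (2 * S)\<^sup>2"
    using trace \<open>0 < \<kappa> * m\<close> \<open>0 \<le> P\<close> by (intro power_mono) auto
  finally have amgm: "\<kappa> * m * P \<le> S\<^sup>2"
    by (simp add: power_mult_distrib)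
  have cauchy: "S\<^sup>2 \<le> real n * Q"
    using sum_squared_le_sum_of_squares [of v "{1..n}"] by (simp add: S_def Q_def mult.commute)

  have "\<kappa> * m * ((1 - \<mu>\<^sup>2) + real n * \<mu>\<^sup>2) * S\<^sup>2
      = \<kappa> * m * ((1 - \<mu>\<^sup>2) * S\<^sup>2 + real n * (\<mu>\<^sup>2 * S\<^sup>2))"
    by (simp add: algebra_simps)
  also have "\<dots> \<le> \<kappa> * m * ((1 - \<mu>\<^sup>2) * (real n * Q) + real n * (\<mu>\<^sup>2 * S\<^sup>2))"
    using cauchy \<open>0 \<le> 1 - \<mu>\<^sup>2\<close> \<open>0 < \<kappa> * m\<close> by (intro mult_left_mono add_right_mono) auto
  also have "\<dots> = real n * (\<kappa> * m * P)"
    by (simp add: P_def algebra_simps)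
  also have "\<dots> \<le> real n * S\<^sup>2"
    using amgm by (intro mult_left_mono) auto
  finally have "\<kappa> * m * ((1 - \<mu>\<^sup>2) + real n * \<mu>\<^sup>2) \<le> real n"
    using \<open>0 < S\<close> by simp
  then have "(real N - 1) * (\<kappa> * m * ((1 - \<mu>\<^sup>2) + real n * \<mu>\<^sup>2)) \<le> (real N - 1) * real n"
    using m by (intro mult_left_mono) auto
  moreover have "(real N - 1) * (\<kappa> * m * ((1 - \<mu>\<^sup>2) + real n * \<mu>\<^sup>2))
      = \<kappa> * (real N * (m - 1) + real n * (real N - m))"
    unfolding one_minus unfolding \<mu>_sq using m by (simp add: divide_simps)
  ultimately have "real N * \<kappa> * (m - 1) \<le> real n * ((m - 1) + (real N - m) * \<epsilon>\<^sup>2)"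
    by (simp add: \<kappa>_def algebra_simps)
  also have "\<dots> = real n * (1 + (real N - m) / (m - 1) * \<epsilon>\<^sup>2) * (m - 1)"
    using m by (simp add: field_simps)
  finally have "real N * \<kappa> \<le> real n * (1 + (real N - m) / (m - 1) * \<epsilon>\<^sup>2)"
    using m by simp
  moreover have "0 < 1 + (real N - m) / (m - 1) * \<epsilon>\<^sup>2"
    using m by (intro add_pos_nonneg) auto
  ultimately have "real N * \<kappa> / (1 + (real N - m) / (m - 1) * \<epsilon>\<^sup>2) \<le> real n"
    by (simp add: divide_le_eq)
  with m(2) show ?thesis
    by (simp add: m_def \<kappa>_def)
qed

end
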